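(* Let $k \ge 3$, let $r_1 \geq r_2 \geq \cdots \geq r_k\ge 1$ be integers, and let $n = \sum_{i=1}^{k} r_i$. Then $A_{\text{no3l}}(r_1, r_2, \ldots, r_k) \leq n - \max(2, r_k+1)$.
   Context: $A_{\text{no3l}}(r_1,r_2,\dots,r_k)$ denotes the minimum, over all choices of pairwise disjoint sets $\mathcal P_1,\dots,\mathcal P_k\subset\mathbb{R}^2$ with $|\mathcal P_i| = r_i$ and such that no three of the $n$ points lie on a line, of the number of distinct values in $(0,\pi)$ of angles $\angle xyz$ whose three points $x,y,z$ lie in three distinct sets among $\mathcal P_1,\dots,\mathcal P_k$. *)

theory Defs
  imports "HOL-Analysis.Analysis"
begin

text \<open>The unoriented angle at the vertex \<open>y\<close>, in \<open>[0, pi]\<close>. For \<open>x = y\<close> or \<open>z = y\<close>, which does not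
  occur below, it takes the junk value \<open>pi / 2\<close>.\<close>

definition angle :: "real ^ 2 \<Rightarrow> real ^ 2 \<Rightarrow> real ^ 2 \<Rightarrow> real" where
  "angle x y z = arccos (((x - y) \<bullet> (z - y)) / (norm (x - y) * norm (z - y)))"

definition no_three_on_line :: "(real ^ 2) set \<Rightarrow> bool" where
  "no_three_on_line S \<longleftrightarrow>
     (\<forall>x\<in>S. \<forall>y\<in>S. \<forall>z\<in>S. x \<noteq> y \<longrightarrow> y \<noteq> z \<longrightarrow> x \<noteq> z \<longrightarrow> \<not> collinear {x, y, z})"

definition no3l_config :: "nat \<Rightarrow> (nat \<Rightarrow> nat) \<Rightarrow> (nat \<Rightarrow> (real ^ 2) set) \<Rightarrow> bool" where
  "no3l_config k r P \<longleftrightarrow>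
     disjoint_family_on P {1..k} \<and>
     (\<forall>i\<in>{1..k}. finite (P i) \<and> card (P i) = r i) \<and>
     no_three_on_line (\<Union>i\<in>{1..k}. P i)"

definition rainbow_angles :: "nat \<Rightarrow> (nat \<Rightarrow> (real ^ 2) set) \<Rightarrow> real set" where
  "rainbow_angles k P =
     {\<theta>. 0 < \<theta> \<and> \<theta> < pi \<and>
        (\<exists>a\<in>{1..k}. \<exists>b\<in>{1..k}. \<exists>c\<in>{1..k}. a \<noteq> b \<and> b \<noteq> c \<and> a \<noteq> c \<and>
           (\<exists>x\<in>P a. \<exists>y\<in>P b. \<exists>z\<in>P c. \<theta> = angle x y z))}"

text \<open>The minimum is written as a least natural number; the lemmas \<open>ex_no3l_config\<close>,
  \<open>finite_rainbow_angles\<close> and \<open>A_no3l_attained\<close> below show that it is a genuine minimum, over a nonempty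
  family of configurations, of cardinalities of finite sets.\<close>

definition A_no3l :: "nat \<Rightarrow> (nat \<Rightarrow> nat) \<Rightarrow> nat" where
  "A_no3l k r = (LEAST m. \<exists>P. no3l_config k r P \<and> m = card (rainbow_angles k P))"

lemma not_collinear_parabola:
  fixes a b c :: real
  assumes "a \<noteq> b" "b \<noteq> c" "a \<noteq> c"
  shows "\<not> collinear {vector [a, a\<^sup>2] :: real ^ 2, vector [b, b\<^sup>2], vector [c, c\<^sup>2]}"
proof
  assume "collinear {vector [a, a\<^sup>2] :: real ^ 2, vector [b, b\<^sup>2], vector [c, c\<^sup>2]}"
  then consider "(vector [a, a\<^sup>2] :: real ^ 2) = vector [c, c\<^sup>2]"
    | u where "(vector [b, b\<^sup>2] :: real ^ 2) = u *\<^sub>R vector [a, a\<^sup>2] + (1 - u) *\<^sub>R vector [c, c\<^sup>2]"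
    unfolding collinear_3_expand by blast
  then show False
  proof cases
    case 1
    then have "a = c" by (metis vector_2(1))
    with assms show False by simp
  next
    case 2
    have b1: "b = u * a + (1 - u) * c"
      using arg_cong[OF 2, of "\<lambda>v. v $ 1"] by simp
    have b2: "b\<^sup>2 = u * a\<^sup>2 + (1 - u) * c\<^sup>2"
      using arg_cong[OF 2, of "\<lambda>v. v $ 2"] by simp
    have "u * (1 - u) * (a - c)\<^sup>2 = 0"
      using b2 unfolding b1 by (simp add: power2_eq_square algebra_simps)
    then have "u = 0 \<or> u = 1" using assms by simp
    with b1 assms show False by auto
  qed
qed

lemma ex_no3l_config: "\<exists>P. no3l_config k r P"
proof -
  define pt :: "nat \<Rightarrow> real ^ 2" where "pt = (\<lambda>m. vector [real m, (real m)\<^sup>2])"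
  define P where "P = (\<lambda>i. (\<lambda>m. pt (prod_encode (i, m))) ` {..<r i})"
  have inj: "pt m = pt m' \<longleftrightarrow> m = m'" for m m'
    unfolding pt_def by (metis of_nat_eq_iff vector_2(1))
  have "disjoint_family_on P {1..k}"
    by (auto simp: disjoint_family_on_def P_def inj)
  moreover have "finite (P i) \<and> card (P i) = r i" for i
    by (auto simp: P_def inj inj_on_def card_image)
  moreover have "no_three_on_line (range pt)"
    by (auto simp: no_three_on_line_def inj)
       (auto simp: pt_def not_collinear_parabola)
  then have "no_three_on_line (\<Union>i\<in>{1..k}. P i)"
    by (fastforce simp: no_three_on_line_def P_def)
  ultimately show ?thesis
    unfolding no3l_config_def by blast
qed

lemma finite_rainbow_angles:
  assumes "no3l_config k r P"
  shows "finite (rainbow_angles k P)"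
proof -
  let ?S = "\<Union>i\<in>{1..k}. P i"
  have "finite ?S" using assms by (auto simp: no3l_config_def)
  then have "finite ((\<lambda>(x, y, z). angle x y z) ` (?S \<times> ?S \<times> ?S))" by blast
  moreover have "rainbow_angles k P \<subseteq> (\<lambda>(x, y, z). angle x y z) ` (?S \<times> ?S \<times> ?S)"
    by (force simp: rainbow_angles_def)
  ultimately show ?thesis by (rule finite_subset[rotated])
qed

lemma A_no3l_attained:
  shows "\<exists>P. no3l_config k r P \<and> card (rainbow_angles k P) = A_no3l k r"
    and "no3l_config k r Q \<Longrightarrow> A_no3l k r \<le> card (rainbow_angles k Q)"
proof -
  have "\<exists>m P. no3l_config k r P \<and> m = card (rainbow_angles k P)"
    using ex_no3l_config by blast
  from LeastI_ex[OF this] show "\<exists>P. no3l_config k r P \<and> card (rainbow_angles k P) = A_no3l k r"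
    unfolding A_no3l_def by metis
  show "no3l_config k r Q \<Longrightarrow> A_no3l k r \<le> card (rainbow_angles k Q)"
    unfolding A_no3l_def by (rule Least_le) blast
qed

end

theory Submission
  imports Defs
begin

text \<open>Take the vertices of a regular \<open>n\<close>-gon and let each class be a block of consecutive vertices.
  By the inscribed angle theorem, the angle at \<open>y\<close> is \<open>j * pi / n\<close>, where \<open>j\<close> is the number of edges on
  the arc from \<open>x\<close> to \<open>z\<close> avoiding \<open>y\<close>. If \<open>x\<close> and \<open>z\<close> lie outside the block of \<open>y\<close>, the other arc, with
  \<open>n - j\<close> edges, has the whole block of \<open>y\<close> in its interior, so \<open>1 \<le> j \<le> n - 1 - r k\<close>.\<close>

text \<open>The parameter is half the polar angle, so that inscribed angles become differences of
  parameters, up to supplements.\<close>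

definition circle_point :: "real \<Rightarrow> real ^ 2" where
  "circle_point t = vector [cos (2 * t), sin (2 * t)]"

lemma norm_circle_point [simp]: "norm (circle_point t) = 1"
  by (simp add: circle_point_def norm_eq_sqrt_inner inner_vec_def sum_2 flip: power2_eq_square)

text \<open>By the sum-to-product formulas a chord is a signed length times a unit vector that
  depends on \<open>s + t\<close> only.\<close>

lemma circle_point_diff:
  "circle_point s - circle_point t = (2 * sin (s - t)) *\<^sub>R vector [- sin (s + t), cos (s + t)]"
proof -
  have "cos (2 * s) - cos (2 * t) = 2 * sin (s + t) * sin (t - s)"
    using cos_diff_cos[of "2 * s" "2 * t"] by (simp add: add_divide_distrib diff_divide_distrib)
  moreover have "sin (t - s) = - sin (s - t)"
    using sin_minus[of "s - t"] by simp
  moreover have "sin (2 * s) - sin (2 * t) = 2 * sin (s - t) * cos (s + t)"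
    using sin_diff_sin[of "2 * s" "2 * t"] by (simp add: add_divide_distrib diff_divide_distrib)
  ultimately show ?thesis
    by (simp add: circle_point_def vec_eq_iff forall_2)
qed

text \<open>Inscribed angle theorem: the two chords at \<open>b\<close> have directions given by
  \<open>a + b\<close> and \<open>c + b\<close>, so \<open>b\<close> cancels in the inner product.
  The vertex survives only in the signs of the chord lengths, which choose between an angle and its
  supplement.\<close>

lemma angle_circle_point:
  "angle (circle_point a) (circle_point b) (circle_point c) =
     arccos (sgn (sin (a - b)) * sgn (sin (c - b)) * cos (c - a))"
proof -
  let ?u = "\<lambda>t :: real. vector [- sin t, cos t] :: real ^ 2"
  have norm_u: "norm (?u t) = 1" for t
    by (simp add: norm_eq_sqrt_inner inner_vec_def sum_2 flip: power2_eq_square)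
  have "?u (a + b) \<bullet> ?u (c + b) = cos ((c + b) - (a + b))"
    unfolding cos_diff by (simp add: inner_vec_def sum_2 mult.commute)
  then have inner_u: "?u (a + b) \<bullet> ?u (c + b) = cos (c - a)"
    by simp
  show ?thesis
    unfolding angle_def circle_point_diff inner_scaleR_left inner_scaleR_right norm_scaleR norm_u inner_u
      real_sgn_eq abs_mult
    by (simp add: mult_ac)
qed

lemma angle_commute: "angle x y z = angle z y x"
  by (simp add: angle_def inner_commute mult.commute)

text \<open>A line meets a sphere in at most two points: inserting
  \<open>b = u *\<^sub>R a + (1 - u) *\<^sub>R c\<close> into the equation of the sphere leaves
  \<open>u * (1 - u)\<close> times the squared distance of \<open>a\<close> and \<open>c\<close>
  equal to zero.\<close>

lemma not_collinear_sphere: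
  fixes a b c :: "'a :: euclidean_space"
  assumes norms: "norm a = \<rho>" "norm b = \<rho>" "norm c = \<rho>"
    and ne: "a \<noteq> b" "b \<noteq> c" "a \<noteq> c"
  shows "\<not> collinear {a, b, c}"
proof
  assume "collinear {a, b, c}"
  with ne obtain u where b: "b = u *\<^sub>R a + (1 - u) *\<^sub>R c"
    unfolding collinear_3_expand by blast
  have sq: "a \<bullet> a = \<rho>\<^sup>2" "b \<bullet> b = \<rho>\<^sup>2" "c \<bullet> c = \<rho>\<^sup>2"
    using norms by (auto simp: dot_square_norm)
  have "b \<bullet> b = u * u * (a \<bullet> a) + (1 - u) * (1 - u) * (c \<bullet> c) + 2 * u * (1 - u) * (a \<bullet> c)"
    unfolding b by (simp add: inner_add_left inner_add_right inner_commute algebra_simps)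
  then have "u * (1 - u) * (2 * \<rho>\<^sup>2 - 2 * (a \<bullet> c)) = 0"
    unfolding sq by (simp add: algebra_simps)
  moreover have "(a - c) \<bullet> (a - c) = 2 * \<rho>\<^sup>2 - 2 * (a \<bullet> c)"
    by (simp add: inner_diff_left inner_diff_right inner_commute sq)
  ultimately have "u = 0 \<or> u = 1"
    using ne by auto
  with b ne show False by auto
qed

definition ngon :: "nat \<Rightarrow> nat \<Rightarrow> real ^ 2" where
  "ngon n m = circle_point (pi * real m / real n)"

lemma sin_pi_diff_pos:
  assumes "x < z" "z < n"
  shows "sin (pi * real z / real n - pi * real x / real n) > 0"
proof (rule sin_gt_zero)
  have eq: "pi * real z / real n - pi * real x / real n = pi * ((real z - real x) / real n)"
    by (simp add: algebra_simps diff_divide_distrib)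
  have "0 < (real z - real x) / real n" "(real z - real x) / real n < 1"
    using assms by auto
  then show "0 < pi * real z / real n - pi * real x / real n"
    "pi * real z / real n - pi * real x / real n < pi"
    unfolding eq using mult_strict_left_mono[of _ 1 pi] by (auto simp del: times_divide_eq_right)
qed

lemma sin_pi_diff_neg:
  assumes "x < z" "z < n"
  shows "sin (pi * real x / real n - pi * real z / real n) < 0"
  using sin_pi_diff_pos[OF assms] sin_minus[of "pi * real z / real n - pi * real x / real n"]
  by simp

text \<open>The chord between two such vertices has nonzero signed length, since half the difference
  of their polar angles lies strictly between 0 and \<open>pi\<close>, and its direction is a unit
  vector.\<close>

lemma inj_on_ngon: "inj_on (ngon n) {..<n}"
proof (rule linorder_inj_onI')
  fix x z assume "x \<in> {..<n}" "z \<in> {..<n}" "x < z"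
  let ?a = "\<lambda>m. pi * real m / real n"
  let ?s = "?a z + ?a x"
  have pos: "sin (?a z - ?a x) > 0"
    using \<open>x < z\<close> \<open>z \<in> {..<n}\<close> by (simp add: sin_pi_diff_pos)
  show "ngon n x \<noteq> ngon n z"
  proof
    assume "ngon n x = ngon n z"
    then have "(2 * sin (?a z - ?a x)) *\<^sub>R (vector [- sin ?s, cos ?s] :: real ^ 2) = 0"
      unfolding ngon_def by (simp flip: circle_point_diff)
    then have "(vector [- sin ?s, cos ?s] :: real ^ 2) = 0"
      using pos by simp
    then have "sin ?s = 0" "cos ?s = 0"
      by (auto simp: vec_eq_iff forall_2)
    then show False
      using sin_cos_squared_add[of ?s] by simp
  qed
qed

lemma no_three_on_line_ngon: "no_three_on_line (range (ngon n))"
  unfolding no_three_on_line_def ngon_def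
  by (intro ballI impI not_collinear_sphere[where \<rho> = 1]) auto

text \<open>If \<open>y\<close> lies between \<open>x\<close> and \<open>z\<close> in the index
  order, the two sines have opposite signs and the supplement appears: the arc avoiding
  \<open>y\<close> then wraps around past index 0. Otherwise the signs agree.\<close>

lemma angle_ngon:
  assumes "x < z" "z < n" "y < n" "y \<noteq> x" "y \<noteq> z"
  shows "angle (ngon n x) (ngon n y) (ngon n z) =
           pi * real (if x < y \<and> y < z then n - (z - x) else z - x) / real n"
proof -
  let ?a = "\<lambda>m. pi * real m / real n"
  have diff: "?a z - ?a x = pi * real (z - x) / real n"
    using \<open>x < z\<close> by (simp add: of_nat_diff algebra_simps diff_divide_distrib)
  have compl: "pi - ?a z + ?a x = pi * real (n - (z - x)) / real n"
    using assms by (simp add: of_nat_diff field_simps)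
  have range: "0 \<le> pi * real m / real n" "pi * real m / real n \<le> pi" if "m \<le> n" for m
    using that by (auto simp: divide_le_eq)
  consider "y < x" | "x < y" "y < z" | "z < y"
    using assms by linarith
  then show ?thesis
  proof cases
    case 1
    then have "sin (?a x - ?a y) > 0" "sin (?a z - ?a y) > 0"
      using assms by (auto intro: sin_pi_diff_pos)
    then show ?thesis
      unfolding ngon_def using 1 assms range[of "z - x"]
      by (simp add: angle_circle_point diff arccos_cos)
  next
    case 2
    then have "sin (?a x - ?a y) < 0" "sin (?a z - ?a y) > 0"
      using assms by (auto intro: sin_pi_diff_pos sin_pi_diff_neg)
    moreover have "- cos (?a z - ?a x) = cos (pi * real (n - (z - x)) / real n)"
      unfolding compl[symmetric] using cos_pi_minus[of "?a z - ?a x"] by (simp add: algebra_simps)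
    ultimately show ?thesis
      unfolding ngon_def using 2 assms range[of "n - (z - x)"]
      by (simp add: angle_circle_point arccos_cos)
  next
    case 3
    then have "sin (?a x - ?a y) < 0" "sin (?a z - ?a y) < 0"
      using assms by (auto intro: sin_pi_diff_neg)
    then show ?thesis
      unfolding ngon_def using 3 assms range[of "z - x"]
      by (simp add: angle_circle_point diff arccos_cos)
  qed
qed

lemma angle_ngon_outside_block:
  assumes "x < n" "z < n" "x \<noteq> z" "l \<le> y" "y < u" "u \<le> n"
    and "x \<notin> {l..<u}" "z \<notin> {l..<u}"
  shows "\<exists>j\<in>{1..n - 1 - (u - l)}. angle (ngon n x) (ngon n y) (ngon n z) = pi * real j / real n"
  using assms
proof (induction x z rule: linorder_wlog)
  case (le x z)
  let ?j = "if x < y \<and> y < z then n - (z - x) else z - x"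
  have "x < z" "y < n" "y \<noteq> x" "y \<noteq> z" and "z < n"
    using le by auto
  \<comment> \<open>The block \<open>{l..<u}\<close> contains \<open>y\<close> but neither
    \<open>x\<close> nor \<open>z\<close>, so it lies on the same side of each as \<open>y\<close>.
    Between them it forces \<open>z - x \<ge> u - l + 1\<close>; below \<open>x\<close> or above
    \<open>z\<close> it leaves at most \<open>n - (u - l)\<close> indices for \<open>x\<close> to
    \<open>z\<close>.\<close>
  moreover have "?j \<in> {1..n - 1 - (u - l)}"
    using le by auto
  ultimately show ?case
    using angle_ngon by blast
next
  case (sym x z)
  show ?case
    unfolding angle_commute[of "ngon n x"] by (rule sym.IH) (use sym.prems in auto)
qed

theorem lemma5p9:
  fixes k n :: nat and r :: "nat \<Rightarrow> nat"
  assumes "k \<ge> 3"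
    and "\<And>i j. 1 \<le> i \<Longrightarrow> i \<le> j \<Longrightarrow> j \<le> k \<Longrightarrow> r i \<ge> r j"
    and "r k \<ge> 1"
    and "n = (\<Sum>i=1..k. r i)"
  shows "int (A_no3l k r) \<le> int n - max 2 (int (r k) + 1)"
proof -
  \<comment> \<open>Partial sums cut \<open>{..<n}\<close> into consecutive blocks, the
    \<open>i\<close>-th of length \<open>r i\<close>; \<open>s 0 = 0\<close> starts the
    first.\<close>
  define s where "s = (\<lambda>i. \<Sum>j=1..i. r j)"
  define block where "block = (\<lambda>i. {s (i - 1)..<s i})"
  define P where "P = (\<lambda>i. ngon n ` block i)"
  have s_mono: "s i \<le> s j" if "i \<le> j" for i j
    unfolding s_def using that by (intro sum_mono2) auto
  have s_k: "s k = n"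
    using assms(4) by (simp add: s_def)
  have s_step: "s i = s (i - 1) + r i" if "1 \<le> i" for i
    using that by (cases i) (auto simp: s_def)
  have block_sub: "block i \<subseteq> {..<n}" if "i \<le> k" for i
    using s_mono[OF that] s_k by (auto simp: block_def)
  have block_disj: "block i \<inter> block j = {}" if "i \<noteq> j" for i j
    using that
  proof (induction i j rule: linorder_wlog)
    case (le i j)
    then have "s i \<le> s (j - 1)" by (intro s_mono) simp
    then show ?case by (auto simp: block_def)
  qed auto
  have config: "no3l_config k r P"
    unfolding no3l_config_def
  proof (intro conjI ballI)
    show "disjoint_family_on P {1..k}"
      unfolding disjoint_family_on_def
    proof (intro ballI impI)
      fix i j assume "i \<in> {1..k}" "j \<in> {1..k}" "i \<noteq> j"
      then show "P i \<inter> P j = {}"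
        unfolding P_def using inj_on_image_Int[OF inj_on_ngon[of n] block_sub block_sub, of i j]
        by (simp add: block_disj)
    qed
  next
    fix i assume i: "i \<in> {1..k}"
    show "finite (P i)" by (simp add: P_def block_def)
    have "card (P i) = card (block i)"
      unfolding P_def using i by (intro card_image inj_on_subset[OF inj_on_ngon] block_sub) simp
    also have "\<dots> = r i"
      using i s_step[of i] by (simp add: block_def)
    finally show "card (P i) = r i" .
  next
    show "no_three_on_line (\<Union>i\<in>{1..k}. P i)"
      using no_three_on_line_ngon[of n] by (fastforce simp: no_three_on_line_def P_def)
  qed
  have "rainbow_angles k P \<subseteq> (\<lambda>j. pi * real j / real n) ` {1..n - 1 - r k}"
  proof
    fix \<theta> assume "\<theta> \<in> rainbow_angles k P"
    then obtain a b c x y z where abc: "a \<in> {1..k}" "b \<in> {1..k}" "c \<in> {1..k}"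
        "a \<noteq> b" "b \<noteq> c" "a \<noteq> c"
      and xyz: "x \<in> block a" "y \<in> block b" "z \<in> block c"
      and \<theta>: "\<theta> = angle (ngon n x) (ngon n y) (ngon n z)"
      unfolding rainbow_angles_def P_def by blast
    have "x < n" "z < n"
      using abc xyz block_sub[of a] block_sub[of c] by auto
    moreover have "x \<noteq> z" "x \<notin> block b" "z \<notin> block b"
      using abc xyz block_disj by blast+
    moreover have "s (b - 1) \<le> y" "y < s b" "s b \<le> n"
      using abc xyz s_mono[of b k] s_k by (auto simp: block_def)
    ultimately obtain j where j: "j \<in> {1..n - 1 - (s b - s (b - 1))}" "\<theta> = pi * real j / real n"
      using angle_ngon_outside_block[of x n z "s (b - 1)" y "s b"] unfolding \<theta> block_def by blast
    \<comment> \<open>The block of the vertex has length \<open>r b\<close>, and the last class is a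
      smallest one.\<close>
    have "r k \<le> s b - s (b - 1)"
      using abc assms(2)[of b k] s_step[of b] by simp
    with j show "\<theta> \<in> (\<lambda>j. pi * real j / real n) ` {1..n - 1 - r k}"
      by auto
  qed
  from card_mono[OF _ this] card_image_le[of "{1..n - 1 - r k}" "\<lambda>j. pi * real j / real n"]
  have "card (rainbow_angles k P) \<le> n - 1 - r k"
    by simp
  then have "A_no3l k r \<le> n - 1 - r k"
    using A_no3l_attained(2)[OF config] by linarith
  \<comment> \<open>The first and last blocks are distinct and \<open>r 1 \<ge> r k \<ge> 1\<close>.
    Hence the truncated subtraction \<open>n - 1 - r k\<close> is exact; the maximum is
    \<open>r k + 1\<close> because \<open>r k \<ge> 1\<close>.\<close>
  moreover have "r k + 1 \<le> n"
    using s_mono[of 1 "k - 1"] s_step[of 1] s_step[of k] s_k assms(1,3) assms(2)[of 1 k] by linarith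
  ultimately show ?thesis
    using assms(3) by simp
qed

end
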